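(* Let $n\geq t\geq 1$ be integers. There exists a signed magic square $SMS(n;t)$ if and only if either $n=t=1$, or both $n>2$ and $t>2$.
   Context: For integers $n\ge t\ge 1$, a signed magic square $SMS(n;t)$ is an $n\times n$ array, some of whose cells may be empty, with entries from the set $X$, where $X=\{0,\pm1,\pm2,\ldots,\pm (nt-1)/2\}$ if $nt$ is odd and $X=\{\pm1,\pm2,\ldots,\pm nt/2\}$ if $nt$ is even, such that exactly $t$ cells in every row and exactly $t$ cells in every column are filled, every integer in $X$ appears exactly once in the array, and the sum of (the filled entries of) each row and of each column is zero. *)

theory Defs
  imports Main
begin

definition sms_entries :: "nat \<Rightarrow> nat \<Rightarrow> int set" where
  "sms_entries n t =
     (if odd (n * t) then {- ((int (n * t) - 1) div 2) .. (int (n * t) - 1) div 2}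
      else {- (int (n * t) div 2) .. int (n * t) div 2} - {0})"

text \<open>Rows and columns are indexed by \<open>0, \<dots>, n - 1\<close>; the value \<open>None\<close> marks an empty cell.
  Values of \<open>A\<close> outside this index range are irrelevant.\<close>

definition signed_magic_square ::
    "nat \<Rightarrow> nat \<Rightarrow> (nat \<Rightarrow> nat \<Rightarrow> int option) \<Rightarrow> bool" where
  "signed_magic_square n t A \<longleftrightarrow>
     (\<forall>i<n. \<forall>j<n. \<forall>x. A i j = Some x \<longrightarrow> x \<in> sms_entries n t) \<and>
     (\<forall>i<n. card {j. j < n \<and> A i j \<noteq> None} = t) \<and>
     (\<forall>j<n. card {i. i < n \<and> A i j \<noteq> None} = t) \<and>
     (\<forall>x\<in>sms_entries n t. \<exists>!p. fst p < n \<and> snd p < n \<and> A (fst p) (snd p) = Some x) \<and>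
     (\<forall>i<n. (\<Sum>j | j < n \<and> A i j \<noteq> None. the (A i j)) = 0) \<and>
     (\<forall>j<n. (\<Sum>i | i < n \<and> A i j \<noteq> None. the (A i j)) = 0)"

end

theory Submission
  imports Defs
begin

text \<open>Necessity: with \<open>t = 1\<close> every entry is \<open>0\<close>, and with \<open>t = 2\<close> the entry \<open>1\<close> forces two
  copies of \<open>- 1\<close>, one in its row and one in its column.

  For existence, fill \<open>t\<close> consecutive cyclic diagonals. Any array with consecutive magnitudes
  extends by four diagonals \<open>X\<close>, \<open>- X\<close>, \<open>Y\<close>, \<open>- Y\<close>: the rows cancel, and the columns
  telescope as soon as \<open>X + Y\<close> is constant along columns. This reduces everything to
  \<open>t \<in> {0, 3, 5, 6}\<close>. For \<open>t = 3\<close> take, on the outer diagonals, \<open>b\<close> and its transpose minus a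
  constant \<open>K\<close>; then \<open>K - b i - b (i - 1)\<close> has to be put on the middle diagonal, so one needs a
  cyclic arrangement whose sums of neighbours are prescribed. The case \<open>t = 5\<close> is similar, with
  two such symmetric pairs. For \<open>t = 6\<close> and odd \<open>n\<close> three diagonals and their negatives suffice;
  this fails by parity for \<open>n \<equiv> 2\<close> modulo \<open>4\<close>, so for even \<open>n\<close> and \<open>t\<close> the array is
  built from \<open>2 \<times> 2\<close> blocks on cyclic block diagonals instead.\<close>

section \<open>The entry set, and magic squares assembled from cyclic block diagonals\<close>

lemma card_sms_entries: "card (sms_entries n t) = n * t"
proof (cases "odd (n * t)")
  case True
  then obtain k where "n * t = 2 * k + 1" by (elim oddE)
  then show ?thesis using True by (simp add: sms_entries_def)
next
  case False
  then obtain k where k: "n * t = 2 * k" by blast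
  \<comment> \<open>Unary minus binds tighter than \<open>div\<close>; the quotient is exact because
    \<open>n * t\<close> is even.\<close>
  have *: "(- int (n * t)) div 2 = - int k" "int (n * t) div 2 = int k"
    using k by simp_all
  show ?thesis
    unfolding sms_entries_def * using False k by (simp add: card_Diff_subset nat_add_distrib)
qed

lemma mem_sms_entries_iff:
  "x \<in> sms_entries n t \<longleftrightarrow> \<bar>x\<bar> \<le> int (n * t div 2) \<and> (even (n * t) \<longrightarrow> x \<noteq> 0)"
proof (cases "odd (n * t)")
  case True
  then obtain k where "n * t = 2 * k + 1" by (elim oddE)
  then show ?thesis using True by (auto simp: sms_entries_def)
next
  case False
  then obtain k where k: "n * t = 2 * k" by blast
  have "(- int (n * t)) div 2 = - int k" "int (n * t) div 2 = int k"
    using k by simp_all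
  then show ?thesis unfolding sms_entries_def using False k by auto
qed

text \<open>\<open>f d I u v\<close> is the entry at position \<open>(u, v)\<close> of the \<open>w \<times> w\<close> block in block row \<open>I\<close> and
  block column \<open>(I + d) mod m\<close>.\<close>

definition block_cyclic ::
    "nat \<Rightarrow> nat \<Rightarrow> nat \<Rightarrow> (nat \<Rightarrow> int \<Rightarrow> nat \<Rightarrow> nat \<Rightarrow> int) \<Rightarrow> bool" where
  "block_cyclic w m s f \<longleftrightarrow>
     (\<forall>d<s. \<forall>I u v. f d (I mod int m) u v = f d I u v) \<and>
     (\<forall>I. \<forall>u<w. (\<Sum>d<s. \<Sum>v<w. f d I u v) = 0) \<and>
     (\<forall>J. \<forall>v<w. (\<Sum>d<s. \<Sum>u<w. f d (J - int d) u v) = 0) \<and>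
     (\<forall>x\<in>sms_entries (m * w) (s * w). \<exists>d<s. \<exists>I. \<exists>u<w. \<exists>v<w. f d I u v = x)"

text \<open>Since there are as many filled cells as values, it is enough that every value occurs.\<close>

lemma signed_magic_square_surj:
  assumes rows: "\<And>i. i < n \<Longrightarrow> card {j. j < n \<and> A i j \<noteq> None} = t"
    and cols: "\<And>j. j < n \<Longrightarrow> card {i. i < n \<and> A i j \<noteq> None} = t"
    and rowsum: "\<And>i. i < n \<Longrightarrow> (\<Sum>j | j < n \<and> A i j \<noteq> None. the (A i j)) = 0"
    and colsum: "\<And>j. j < n \<Longrightarrow> (\<Sum>i | i < n \<and> A i j \<noteq> None. the (A i j)) = 0"
    and surj: "\<And>x. x \<in> sms_entries n t \<Longrightarrow> \<exists>i<n. \<exists>j<n. A i j = Some x"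
  shows "signed_magic_square n t A"
proof -
  define P where "P = (SIGMA i:{..<n}. {j. j < n \<and> A i j \<noteq> None})"
  define V where "V = (\<lambda>(i, j). the (A i j))"
  have P_iff: "(i, j) \<in> P \<longleftrightarrow> i < n \<and> j < n \<and> A i j \<noteq> None" for i j
    by (auto simp: P_def)
  have finP: "finite P" by (auto simp: P_def)
  have cardP: "card P = n * t"
    unfolding P_def by (subst card_SigmaI) (auto simp: rows simp del: not_None_eq)
  have sub: "sms_entries n t \<subseteq> V ` P"
  proof
    fix x assume "x \<in> sms_entries n t"
    then obtain i j where "i < n" "j < n" "A i j = Some x" using surj by blast
    then have "(i, j) \<in> P" "V (i, j) = x" by (auto simp: P_def V_def)
    then show "x \<in> V ` P" by blast
  qed
  have "card (V ` P) \<le> card (sms_entries n t)"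
    using card_image_le[OF finP] by (simp add: cardP card_sms_entries)
  then have eq: "sms_entries n t = V ` P"
    using card_seteq[OF _ sub] finP by auto
  then have "card (V ` P) = card P" by (metis cardP card_sms_entries)
  then have inj: "inj_on V P" using eq_card_imp_inj_on finP by blast
  have "x \<in> sms_entries n t" if "i < n" "j < n" "A i j = Some x" for i j x
  proof -
    have "(i, j) \<in> P" "V (i, j) = x" using that by (auto simp: P_def V_def)
    then show ?thesis using eq by blast
  qed
  moreover have "\<exists>!p. fst p < n \<and> snd p < n \<and> A (fst p) (snd p) = Some x"
    if x: "x \<in> sms_entries n t" for x
  proof -
    obtain i j where ij: "i < n" "j < n" "A i j = Some x" using surj x by blast
    show ?thesis
    proof (rule ex1I[of _ "(i, j)"])
      show "fst (i, j) < n \<and> snd (i, j) < n \<and> A (fst (i, j)) (snd (i, j)) = Some x"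
        using ij by simp
      fix p assume p: "fst p < n \<and> snd p < n \<and> A (fst p) (snd p) = Some x"
      then have "p \<in> P" "(i, j) \<in> P" "V p = V (i, j)"
        using ij by (cases p; auto simp: P_iff V_def)+
      then show "p = (i, j)" using inj by (auto dest: inj_onD)
    qed
  qed
  ultimately show ?thesis
    unfolding signed_magic_square_def using rows cols rowsum colsum by blast
qed

text \<open>Block row \<open>I\<close> and block column \<open>J\<close> meet on the block diagonal
  \<open>(J - I) mod m\<close>. As \<open>s \<le> m\<close>, the diagonals \<open>d < s\<close> are
  disjoint, so sums over filled cells reindex to the sums in \<open>block_cyclic\<close>.\<close>

lemma signed_magic_square_of_block_cyclic:
  assumes f: "block_cyclic w m s f" and "0 < w" "s \<le> m"
  shows "\<exists>A. signed_magic_square (m * w) (s * w) A"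
proof (cases "m = 0")
  case True
  with \<open>s \<le> m\<close> show ?thesis by (auto simp: signed_magic_square_def sms_entries_def)
next
  case False
  define A where "A = (\<lambda>i j. let d = nat ((int (j div w) - int (i div w)) mod int m) in
    if d < s then Some (f d (int (i div w)) (i mod w) (j mod w)) else None)"
  have per: "f d (I mod int m) u v = f d I u v" if "d < s" for d I u v
    using f that by (simp add: block_cyclic_def)
  have nn: "0 \<le> a mod int m" for a
    using False by simp
  have lt: "w * nat (a mod int m) + v < m * w" if "v < w" for a v
  proof -
    have "nat (a mod int m) < m" using False by (simp add: nat_less_iff)
    then have "w * nat (a mod int m) + w \<le> w * m"
      by (metis Suc_leI mult_Suc_right mult_le_mono2 add.commute)
    then show ?thesis using that by (simp add: mult.commute)
  qed
  have divw: "int ((w * nat (a mod int m) + v) div w) = a mod int m"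
    "(w * nat (a mod int m) + v) mod w = v" if "v < w" for a v
    using that False by auto
  have small: "int (i div w) mod int m = int (i div w)" if "i < m * w" for i
    using that by (simp add: less_mult_imp_div_less)
  have dd: "nat (int d mod int m) = d" if "d < s" for d
    using that \<open>s \<le> m\<close> by simp
  have row: "bij_betw (\<lambda>(d, v). w * nat ((int (i div w) + int d) mod int m) + v)
      ({..<s} \<times> {..<w}) {j. j < m * w \<and> A i j \<noteq> None}" if "i < m * w" for i
  proof (rule bij_betw_byWitness[where
        f' = "\<lambda>j. (nat ((int (j div w) - int (i div w)) mod int m), j mod w)"], goal_cases)
    case 1
    then show ?case using dd nn by (auto simp: divw mod_diff_left_eq)
  next
    case 2
    show ?case
    proof
      fix j assume "j \<in> {j. j < m * w \<and> A i j \<noteq> None}"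
      then have "j < m * w" by simp
      have "(int (i div w) + (int (j div w) - int (i div w)) mod int m) mod int m
          = int (j div w)"
        using small[OF \<open>j < m * w\<close>] by (simp add: mod_add_right_eq)
      then show "(case (nat ((int (j div w) - int (i div w)) mod int m), j mod w) of
          (d, v) \<Rightarrow> w * nat ((int (i div w) + int d) mod int m) + v) = j"
        using False by simp
    qed
  next
    case 3
    then show ?case using dd nn lt by (auto simp: A_def Let_def divw mod_diff_left_eq)
  next
    case 4
    then show ?case using \<open>0 < w\<close> by (auto simp: A_def Let_def split: if_splits)
  qed
  \<comment> \<open>In block column \<open>J\<close>, diagonal \<open>d\<close> occupies block row
    \<open>J - d\<close>, whence the shifted argument in the column condition.\<close>
  have col: "bij_betw (\<lambda>(d, u). w * nat ((int (j div w) - int d) mod int m) + u)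
      ({..<s} \<times> {..<w}) {i. i < m * w \<and> A i j \<noteq> None}" if "j < m * w" for j
  proof (rule bij_betw_byWitness[where
        f' = "\<lambda>i. (nat ((int (j div w) - int (i div w)) mod int m), i mod w)"], goal_cases)
    case 1
    then show ?case using dd nn by (auto simp: divw mod_diff_right_eq)
  next
    case 2
    show ?case
    proof
      fix i assume "i \<in> {i. i < m * w \<and> A i j \<noteq> None}"
      then have "i < m * w" by simp
      have "(int (j div w) - (int (j div w) - int (i div w)) mod int m) mod int m
          = int (i div w)"
        using small[OF \<open>i < m * w\<close>] by (simp add: mod_diff_right_eq)
      then show "(case (nat ((int (j div w) - int (i div w)) mod int m), i mod w) of
          (d, u) \<Rightarrow> w * nat ((int (j div w) - int d) mod int m) + u) = i"
        using False by simp
    qed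
  next
    case 3
    then show ?case using dd nn lt by (auto simp: A_def Let_def divw mod_diff_right_eq)
  next
    case 4
    then show ?case using \<open>0 < w\<close> by (auto simp: A_def Let_def split: if_splits)
  qed
  have Arow: "A i (w * nat ((int (i div w) + int d) mod int m) + v)
      = Some (f d (int (i div w)) (i mod w) v)" if "d < s" "v < w" for i d v
    using that dd nn by (simp add: A_def Let_def divw mod_diff_left_eq)
  have Acol: "A (w * nat ((int (j div w) - int d) mod int m) + u) j
      = Some (f d (int (j div w) - int d) u (j mod w))" if "d < s" "u < w" for j d u
    using that dd nn per by (simp add: A_def Let_def divw mod_diff_right_eq)
  have "signed_magic_square (m * w) (s * w) A"
  proof (rule signed_magic_square_surj)
    fix i assume i: "i < m * w"
    show "card {j. j < m * w \<and> A i j \<noteq> None} = s * w"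
      using bij_betw_same_card[OF row[OF i]] by simp
    have "(\<Sum>j | j < m * w \<and> A i j \<noteq> None. the (A i j))
        = (\<Sum>(d, v)\<in>{..<s} \<times> {..<w}. f d (int (i div w)) (i mod w) v)"
      by (subst sum.reindex_bij_betw[OF row[OF i], symmetric])
        (rule sum.cong, auto simp: Arow)
    also have "\<dots> = 0"
      using f \<open>0 < w\<close> by (simp add: sum.cartesian_product[symmetric] block_cyclic_def)
    finally show "(\<Sum>j | j < m * w \<and> A i j \<noteq> None. the (A i j)) = 0" .
  next
    fix j assume j: "j < m * w"
    show "card {i. i < m * w \<and> A i j \<noteq> None} = s * w"
      using bij_betw_same_card[OF col[OF j]] by simp
    have "(\<Sum>i | i < m * w \<and> A i j \<noteq> None. the (A i j))
        = (\<Sum>(d, u)\<in>{..<s} \<times> {..<w}. f d (int (j div w) - int d) u (j mod w))"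
      by (subst sum.reindex_bij_betw[OF col[OF j], symmetric])
        (rule sum.cong, auto simp: Acol)
    also have "\<dots> = 0"
      using f \<open>0 < w\<close> by (simp add: sum.cartesian_product[symmetric] block_cyclic_def)
    finally show "(\<Sum>i | i < m * w \<and> A i j \<noteq> None. the (A i j)) = 0" .
  next
    fix x assume "x \<in> sms_entries (m * w) (s * w)"
    then obtain d I u v where *: "d < s" "u < w" "v < w" "f d I u v = x"
      using f unfolding block_cyclic_def by blast
    define i where "i = w * nat (I mod int m) + u"
    have "int (i div w) = I mod int m" "i mod w = u" using * nn by (simp_all add: i_def divw)
    then have "A i (w * nat ((int (i div w) + int d) mod int m) + v) = Some x"
      using Arow[of d v i] * per by simp
    moreover have "i < m * w" using * lt by (simp add: i_def)
    ultimately show "\<exists>i<m * w. \<exists>j<m * w. A i j = Some x" using * lt by blast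
  qed
  then show ?thesis by blast
qed

section \<open>General schemes for arrays of cyclic diagonals\<close>

text \<open>Blocks of size 1: \<open>f d i\<close> sits in row \<open>i\<close> and column
  \<open>(i + d) mod n\<close>.\<close>

definition diagonals :: "nat \<Rightarrow> nat \<Rightarrow> (nat \<Rightarrow> int \<Rightarrow> int) \<Rightarrow> bool" where
  "diagonals n t f \<longleftrightarrow> block_cyclic 1 n t (\<lambda>d i u v. f d i)"

lemma diagonals_iff:
  "diagonals n t f \<longleftrightarrow>
     (\<forall>d<t. \<forall>i. f d (i mod int n) = f d i) \<and>
     (\<forall>i. (\<Sum>d<t. f d i) = 0) \<and>
     (\<forall>i. (\<Sum>d<t. f d (i - int d)) = 0) \<and>
     (\<forall>x\<in>sms_entries n t. \<exists>d<t. \<exists>i. f d i = x)"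
  by (simp add: diagonals_def block_cyclic_def)

lemma diagonals_0: "diagonals n 0 f"
  by (simp add: diagonals_iff mem_sms_entries_iff)

text \<open>With \<open>j = i - int t\<close>, the new part of column \<open>i\<close> sums to
  \<open>X j - X (j - 1) + Y (j - 2) - Y (j - 3)\<close>, which vanishes because
  \<open>Y j + X (j + 2)\<close> is constant.\<close>

lemma diagonals_add_4:
  assumes f: "diagonals n t f" and "0 < n"
  shows "\<exists>f. diagonals n (t + 4) f"
proof -
  \<comment> \<open>\<open>s\<close> is the largest old magnitude; \<open>X\<close> runs through
    \<open>s + 1, ..., s + n\<close> and \<open>Y\<close> through
    \<open>s + n + 1, ..., s + 2 * n\<close>.\<close>
  define s where "s = int (n * t div 2)"
  define X where "X = (\<lambda>i. s + 1 + i mod int n)"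
  define Y where "Y = (\<lambda>i. 2 * s + 2 * int n + 1 - X (i + 2))"
  define g where "g = (\<lambda>d i. if d < t then f d i else if d = t then X i
    else if d = t + 1 then - X i else if d = t + 2 then Y i else - Y i)"
  have sum4: "(\<Sum>d<t + 4. h d) = (\<Sum>d<t. h d) + h t + h (t + 1) + h (t + 2) + h (t + 3)"
    for h :: "nat \<Rightarrow> int"
    by (simp add: numeral_eq_Suc)
  have X: "X (i mod int n) = X i" and Y: "Y (i mod int n) = Y i" for i
    by (simp_all add: X_def Y_def mod_add_left_eq)
  have s4: "int (n * (t + 4) div 2) = s + 2 * int n"
    by (simp add: s_def algebra_simps)
  have "\<exists>d<t + 4. \<exists>i. g d i = x" if x: "x \<in> sms_entries n (t + 4)" for x
  proof -
    have bound: "\<bar>x\<bar> \<le> s + 2 * int n"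
      using x s4 by (simp add: mem_sms_entries_iff)
    consider "\<bar>x\<bar> \<le> s" | "s < \<bar>x\<bar>" "\<bar>x\<bar> \<le> s + int n" | "s + int n < \<bar>x\<bar>"
      by linarith
    then show ?thesis
    proof cases
      case 1
      then have "x \<in> sms_entries n t"
        using x by (auto simp: mem_sms_entries_iff s_def)
      then obtain d i where "d < t" "f d i = x" using f by (auto simp: diagonals_iff)
      then show ?thesis by (intro exI[of _ d] conjI exI[of _ i]) (simp_all add: g_def)
    next
      case 2
      then have "X (\<bar>x\<bar> - s - 1) = \<bar>x\<bar>" by (simp add: X_def)
      then have "g (if x \<ge> 0 then t else t + 1) (\<bar>x\<bar> - s - 1) = x"
        by (auto simp: g_def)
      then show ?thesis by (intro exI[of _ "if x \<ge> 0 then t else t + 1"] conjI exI) auto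
    next
      case 3
      then have "Y (s + 2 * int n - 2 - \<bar>x\<bar>) = \<bar>x\<bar>"
        using bound by (simp add: X_def Y_def)
      then have "g (if x \<ge> 0 then t + 2 else t + 3) (s + 2 * int n - 2 - \<bar>x\<bar>) = x"
        by (auto simp: g_def)
      then show ?thesis by (intro exI[of _ "if x \<ge> 0 then t + 2 else t + 3"] conjI exI) auto
    qed
  qed
  moreover have "(\<Sum>d<t + 4. g d i) = 0" for i
    using f by (simp add: sum4) (simp add: g_def diagonals_iff)
  moreover have "(\<Sum>d<t + 4. g d (i - int d)) = 0" for i
    using f by (simp add: sum4) (simp add: g_def diagonals_iff Y_def diff_diff_eq add.commute)
  ultimately have "diagonals n (t + 4) g"
    using f X Y by (auto simp: diagonals_iff g_def)
  then show ?thesis by blast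
qed

lemma diagonals_add_multiple_4:
  assumes "diagonals n t f" and "0 < n"
  shows "\<exists>f. diagonals n (t + 4 * k) f"
proof (induction k)
  case 0
  then show ?case using assms by auto
next
  case (Suc k)
  then obtain f where "diagonals n (t + 4 * k) f" by blast
  from diagonals_add_4[OF this \<open>0 < n\<close>] show ?case by (simp add: ac_simps)
qed

text \<open>Shift the columns cyclically so that the middle diagonal becomes the main one. Then
  \<open>b i\<close> at \<open>(i, i + 1)\<close> is mirrored by \<open>b i - K\<close> at
  \<open>(i + 1, i)\<close>, so row \<open>i\<close> and column \<open>i\<close> have the same
  off-diagonal sum \<open>b i + b (i - 1) - K\<close>, and one diagonal entry cancels both.\<close>

lemma diagonals_3:
  assumes b: "\<And>i. b (i mod int n) = b i"
    and cover: "\<And>x. x \<in> sms_entries n 3 \<Longrightarrow>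
      \<exists>i. x = b i \<or> x = b i - K \<or> x = K - b i - b (i - 1)"
  shows "\<exists>f. diagonals n 3 f"
proof -
  define f where "f = (\<lambda>d i. if d = (0::nat) then b (i - 1) - K
    else if d = 1 then K - b i - b (i - 1) else b i)"
  have b': "b (i mod int n - k) = b (i - k)" for i k
    by (metis b mod_diff_left_eq)
  have "\<exists>d<3. \<exists>i. f d i = x" if x: "x \<in> sms_entries n 3" for x
  proof -
    obtain i where "x = b i \<or> x = b i - K \<or> x = K - b i - b (i - 1)"
      using cover[OF x] by blast
    then have "f 2 i = x \<or> f 0 (i + 1) = x \<or> f 1 i = x" by (auto simp: f_def)
    moreover have "(0::nat) < 3" "(1::nat) < 3" "(2::nat) < 3" by simp_all
    ultimately show ?thesis by metis
  qed
  moreover have "(\<Sum>d<3. f d i) = 0" "(\<Sum>d<3. f d (i - int d)) = 0" for i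
    by (simp_all add: numeral_eq_Suc f_def)
  ultimately have "diagonals n 3 f"
    by (auto simp: diagonals_iff f_def b b')
  then show ?thesis by blast
qed

text \<open>The same mirror symmetry, with a second pair at distance two from the middle diagonal
  and its own shift \<open>L\<close>.\<close>

lemma diagonals_5:
  assumes b: "\<And>i. b (i mod int n) = b i" and c: "\<And>i. c (i mod int n) = c i"
    and cover: "\<And>x. x \<in> sms_entries n 5 \<Longrightarrow>
      \<exists>i. x = b i \<or> x = b i - K \<or> x = c i \<or> x = c i - L \<or>
        x = K + L - b i - b (i - 1) - c i - c (i - 2)"
  shows "\<exists>f. diagonals n 5 f"
proof -
  define f where "f = (\<lambda>d i. if d = (0::nat) then c (i - 2) - L
    else if d = 1 then b (i - 1) - K
    else if d = 2 then K + L - b i - b (i - 1) - c i - c (i - 2)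
    else if d = 3 then b i else c i)"
  have b': "b (i mod int n - k) = b (i - k)" and c': "c (i mod int n - k) = c (i - k)" for i k
    by (metis b mod_diff_left_eq, metis c mod_diff_left_eq)
  have "\<exists>d<5. \<exists>i. f d i = x" if x: "x \<in> sms_entries n 5" for x
  proof -
    obtain i where "x = b i \<or> x = b i - K \<or> x = c i \<or> x = c i - L \<or>
        x = K + L - b i - b (i - 1) - c i - c (i - 2)"
      using cover[OF x] by blast
    then have "f 3 i = x \<or> f 1 (i + 1) = x \<or> f 4 i = x \<or> f 0 (i + 2) = x \<or> f 2 i = x"
      by (auto simp: f_def)
    moreover have "(0::nat) < 5" "(1::nat) < 5" "(2::nat) < 5" "(3::nat) < 5" "(4::nat) < 5"
      by simp_all
    ultimately show ?thesis by metis
  qed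
  moreover have "(\<Sum>d<5. f d i) = 0" "(\<Sum>d<5. f d (i - int d)) = 0" for i
    by (simp_all add: numeral_eq_Suc f_def)
  ultimately have "diagonals n 5 f"
    by (auto simp: diagonals_iff f_def b b' c c')
  then show ?thesis by blast
qed

text \<open>Rows cancel in pairs. The offsets 2 and 4 align the diagonals so that column
  \<open>i\<close> sums to \<open>X i + Y i + Z i\<close> minus the same total at
  \<open>i - 1\<close>.\<close>

lemma diagonals_6:
  assumes X: "\<And>i. X (i mod int n) = X i" and Y: "\<And>i. Y (i mod int n) = Y i"
    and Z: "\<And>i. Z (i mod int n) = Z i"
    and const: "\<And>i. X i + Y i + Z i = C"
    and cover: "\<And>x. x \<in> sms_entries n 6 \<Longrightarrow> \<exists>i. \<bar>x\<bar> = X i \<or> \<bar>x\<bar> = Y i \<or> \<bar>x\<bar> = Z i"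
  shows "\<exists>f. diagonals n 6 f"
proof -
  define f where "f = (\<lambda>d i. if d = (0::nat) then X i else if d = 1 then - X i
    else if d = 2 then Y (i + 2) else if d = 3 then - Y (i + 2)
    else if d = 4 then Z (i + 4) else - Z (i + 4))"
  have Y': "Y (i mod int n + k) = Y (i + k)" and Z': "Z (i mod int n + k) = Z (i + k)" for i k
    by (metis Y mod_add_left_eq, metis Z mod_add_left_eq)
  have "\<exists>d<6. \<exists>i. f d i = x" if x: "x \<in> sms_entries n 6" for x
  proof -
    obtain i where "\<bar>x\<bar> = X i \<or> \<bar>x\<bar> = Y i \<or> \<bar>x\<bar> = Z i" using cover[OF x] by blast
    then have "f 0 i = x \<or> f 1 i = x \<or> f 2 (i - 2) = x \<or> f 3 (i - 2) = x \<or>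
        f 4 (i - 4) = x \<or> f 5 (i - 4) = x"
      by (auto simp: f_def)
    moreover have "(0::nat) < 6" "(1::nat) < 6" "(2::nat) < 6" "(3::nat) < 6" "(4::nat) < 6"
      "(5::nat) < 6"
      by simp_all
    ultimately show ?thesis by metis
  qed
  moreover have "(\<Sum>d<6. f d (i - int d)) = 0" for i
    using const[of i] const[of "i - 1"] by (simp add: numeral_eq_Suc f_def)
  moreover have "(\<Sum>d<6. f d i) = 0" for i
    by (simp add: numeral_eq_Suc f_def)
  ultimately have "diagonals n 6 f"
    by (auto simp: diagonals_iff f_def X Y' Z')
  then show ?thesis by blast
qed

section \<open>Odd order: three, five and six diagonals\<close>

lemma mod_diff_1_eq:
  "(i - 1) mod n = (if i mod n = 0 then n - 1 else i mod n - 1)" if "0 < n" for i n :: int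
proof -
  have "(i - 1) mod n = (i mod n - 1) mod n" by (simp add: mod_diff_left_eq)
  also have "\<dots> = (if i mod n = 0 then n - 1 else i mod n - 1)"
  proof (cases "i mod n = 0")
    case True
    then show ?thesis using that by (simp add: zmod_minus1)
  next
    case False
    have "0 \<le> i mod n" "i mod n < n" using that by simp_all
    then have "(i mod n - 1) mod n = i mod n - 1"
      using False by (intro mod_pos_pos_trivial) linarith+
    then show ?thesis using False by simp
  qed
  finally show ?thesis .
qed

text \<open>Halving modulo \<open>2 * p + 1\<close>, that is
  \<open>i * (p + 1) mod (2 * p + 1)\<close>: the sequence 0, p + 1, 1, p + 2, ..., p.\<close>

definition zigzag :: "int \<Rightarrow> int \<Rightarrow> int" where
  "zigzag p i = (let k = i mod (2 * p + 1) in if even k then k div 2 else k div 2 + p + 1)"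

lemma zigzag_periodic: "zigzag p (i mod (2 * p + 1)) = zigzag p i"
  by (simp add: zigzag_def)

text \<open>Half of \<open>i\<close> plus half of \<open>i - 1\<close> is congruent to
  \<open>i + p\<close>. The integer sums are even consecutive, including the wrap-around, where the
  last value \<open>p\<close> meets 0.\<close>

lemma zigzag_add:
  assumes "0 \<le> p"
  shows "zigzag p i + zigzag p (i - 1) = p + i mod (2 * p + 1)"
proof -
  define k where "k = i mod (2 * p + 1)"
  have "0 \<le> k" "k < 2 * p + 1"
    unfolding k_def using assms by (simp, intro pos_mod_bound) simp
  then show ?thesis
    using assms by (auto simp: zigzag_def Let_def mod_diff_1_eq k_def[symmetric] elim!: evenE oddE)
qed

lemma zigzag_surj:
  assumes "0 \<le> y" "y \<le> 2 * p"
  shows "\<exists>i. zigzag p i = y"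
proof (cases "y \<le> p")
  case True
  then have "zigzag p (2 * y) = y" using assms by (simp add: zigzag_def)
  then show ?thesis ..
next
  case False
  then have "(2 * (y - p - 1) + 1) mod (2 * p + 1) = 2 * (y - p - 1) + 1"
    using assms by (intro mod_pos_pos_trivial) auto
  then have "zigzag p (2 * (y - p - 1) + 1) = y" by (simp add: zigzag_def)
  then show ?thesis ..
qed

lemma diagonals_3_odd:
  assumes "odd n"
  shows "\<exists>f. diagonals n 3 f"
proof -
  obtain q where q: "n = 2 * q + 1" using assms by (elim oddE)
  define p where "p = int q"
  have n: "int n = 2 * p + 1" and p: "0 \<le> p" by (simp_all add: p_def q)
  show ?thesis
  \<comment> \<open>The outer diagonals take all magnitudes from \<open>p + 1\<close> to
    \<open>3 * p + 1\<close>, with both signs; the middle one is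
    \<open>p - i mod (2 * p + 1)\<close>, covering \<open>- p, ..., p\<close>.\<close>
  proof (rule diagonals_3[where b = "\<lambda>i. p + 1 + zigzag p i" and K = "4 * p + 2"])
    show "p + 1 + zigzag p (i mod int n) = p + 1 + zigzag p i" for i
      by (simp add: n zigzag_periodic)
    fix x assume "x \<in> sms_entries n 3"
    then have "\<bar>x\<bar> \<le> 3 * p + 1" by (simp add: mem_sms_entries_iff p_def q)
    then consider "p < x" "x \<le> 3 * p + 1" | "x < - p" "- (3 * p + 1) \<le> x" | "\<bar>x\<bar> \<le> p"
      by linarith
    then show "\<exists>i. x = p + 1 + zigzag p i \<or> x = p + 1 + zigzag p i - (4 * p + 2) \<or>
      x = 4 * p + 2 - (p + 1 + zigzag p i) - (p + 1 + zigzag p (i - 1))"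
    proof cases
      case 1
      then obtain i where "zigzag p i = x - p - 1" using zigzag_surj[of "x - p - 1" p] by auto
      then show ?thesis by (intro exI[of _ i]) simp
    next
      case 2
      then obtain i where "zigzag p i = x + 3 * p + 1"
        using zigzag_surj[of "x + 3 * p + 1" p] by auto
      then show ?thesis by (intro exI[of _ i]) simp
    next
      case 3
      then have "zigzag p (p - x) + zigzag p (p - x - 1) = 2 * p - x"
        using zigzag_add[OF p, of "p - x"] by simp
      then show ?thesis by (intro exI[of _ "p - x"]) simp
    qed
  qed
qed

lemma diagonals_5_odd:
  assumes "odd n"
  shows "\<exists>f. diagonals n 5 f"
proof -
  obtain q where q: "n = 2 * q + 1" using assms by (elim oddE)
  define p where "p = int q"
  have n: "int n = 2 * p + 1" and p: "0 \<le> p" by (simp_all add: p_def q)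
  define b where "b = (\<lambda>i. p + 1 + zigzag p i)"
  \<comment> \<open>\<open>c\<close> covers \<open>3 * p + 2, ..., 5 * p + 2\<close>. The offset 2
    makes \<open>c (i - 2)\<close> cancel the term \<open>i mod (2 * p + 1)\<close> of the neighbour
    sum of \<open>b\<close>, so the middle diagonal is
    \<open>(i + 2) mod (2 * p + 1) - p\<close>.\<close>
  define c where "c = (\<lambda>i. 5 * p + 2 - (i + 2) mod (2 * p + 1))"
  show ?thesis
  proof (rule diagonals_5[where b = b and K = "4 * p + 2" and c = c and L = "8 * p + 4"])
    show "b (i mod int n) = b i" for i by (simp add: b_def n zigzag_periodic)
    show "c (i mod int n) = c i" for i by (simp add: c_def n mod_add_left_eq)
    fix x assume "x \<in> sms_entries n 5"
    then have "\<bar>x\<bar> \<le> 5 * p + 2" by (simp add: mem_sms_entries_iff p_def q)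
    then consider "p < x" "x \<le> 3 * p + 1" | "x < - p" "- (3 * p + 1) \<le> x"
      | "3 * p + 1 < x" "x \<le> 5 * p + 2" | "x < - (3 * p + 1)" "- (5 * p + 2) \<le> x"
      | "\<bar>x\<bar> \<le> p"
      by linarith
    then show "\<exists>i. x = b i \<or> x = b i - (4 * p + 2) \<or> x = c i \<or> x = c i - (8 * p + 4) \<or>
        x = 4 * p + 2 + (8 * p + 4) - b i - b (i - 1) - c i - c (i - 2)"
    proof cases
      case 1
      then obtain i where "zigzag p i = x - p - 1" using zigzag_surj[of "x - p - 1" p] by auto
      then show ?thesis by (intro exI[of _ i]) (simp add: b_def)
    next
      case 2
      then obtain i where "zigzag p i = x + 3 * p + 1"
        using zigzag_surj[of "x + 3 * p + 1" p] by auto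
      then show ?thesis by (intro exI[of _ i]) (simp add: b_def)
    next
      case 3
      then show ?thesis by (intro exI[of _ "5 * p - x"]) (simp add: c_def)
    next
      case 4
      then show ?thesis by (intro exI[of _ "- 3 * p - 4 - x"]) (simp add: c_def)
    next
      case 5
      define i where "i = x + p - 2"
      have "b i + b (i - 1) = 3 * p + 2 + i mod (2 * p + 1)"
        using zigzag_add[OF p, of i] by (simp add: b_def)
      moreover have "(i + 2) mod (2 * p + 1) = x + p" using 5 by (simp add: i_def)
      ultimately show ?thesis by (intro exI[of _ i]) (simp add: c_def)
    qed
  qed
qed

lemma diagonals_6_odd:
  assumes "odd n"
  shows "\<exists>f. diagonals n 6 f"
proof -
  obtain q where q: "n = 2 * q + 1" using assms by (elim oddE)
  define p where "p = int q"
  have n: "int n = 2 * p + 1" and p: "0 \<le> p" by (simp_all add: p_def q)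
  \<comment> \<open>Three consecutive ranges of length \<open>2 * p + 1\<close>; \<open>Z\<close>
    decreases exactly as the zigzag sum in \<open>X + Y\<close> grows.\<close>
  define X where "X = (\<lambda>i. 1 + zigzag p i)"
  define Y where "Y = (\<lambda>i. 2 * p + 2 + zigzag p (i - 1))"
  define Z where "Z = (\<lambda>i. 6 * p + 3 - i mod (2 * p + 1))"
  have Z_surj: "Z (6 * p + 3 - y) = y" if "4 * p + 2 < y" "y \<le> 6 * p + 3" for y
    using that by (simp add: Z_def)
  show ?thesis
  proof (rule diagonals_6[where X = X and Y = Y and Z = Z and C = "9 * p + 6"])
    show "X (i mod int n) = X i" "Z (i mod int n) = Z i" for i
      by (simp_all add: X_def Z_def n zigzag_periodic)
    show "Y (i mod int n) = Y i" for i
      unfolding Y_def n by (metis mod_diff_left_eq zigzag_periodic)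
    show "X i + Y i + Z i = 9 * p + 6" for i
      using zigzag_add[OF p, of i] by (simp add: X_def Y_def Z_def)
    fix x assume "x \<in> sms_entries n 6"
    then have "\<bar>x\<bar> \<le> 6 * p + 3" "x \<noteq> 0" by (simp_all add: mem_sms_entries_iff p_def q)
    then consider "0 < \<bar>x\<bar>" "\<bar>x\<bar> \<le> 2 * p + 1" | "2 * p + 1 < \<bar>x\<bar>" "\<bar>x\<bar> \<le> 4 * p + 2"
      | "4 * p + 2 < \<bar>x\<bar>" "\<bar>x\<bar> \<le> 6 * p + 3"
      by linarith
    then show "\<exists>i. \<bar>x\<bar> = X i \<or> \<bar>x\<bar> = Y i \<or> \<bar>x\<bar> = Z i"
    proof cases
      case 1
      then obtain i where "zigzag p i = \<bar>x\<bar> - 1" using zigzag_surj[of "\<bar>x\<bar> - 1" p] by auto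
      then show ?thesis by (intro exI[of _ i]) (simp add: X_def)
    next
      case 2
      then obtain i where "zigzag p i = \<bar>x\<bar> - 2 * p - 2"
        using zigzag_surj[of "\<bar>x\<bar> - 2 * p - 2" p] by auto
      then show ?thesis by (intro exI[of _ "i + 1"]) (simp add: Y_def)
    next
      case 3
      then show ?thesis using Z_surj by metis
    qed
  qed
qed

section \<open>Even order: three and five diagonals\<close>

text \<open>The outer diagonals use the magnitudes \<open>m + 1, ..., 3 * m\<close>. Since 0 is no
  entry for even \<open>n\<close>, the neighbour sums of \<open>L\<close> must fill an interval
  around \<open>2 * m + 1\<close> except for its midpoint.\<close>

lemma diagonals_3_even_of_cycle:
  assumes n: "int n = 2 * m"
    and L: "\<And>y. 1 \<le> y \<Longrightarrow> y \<le> 2 * m \<Longrightarrow> \<exists>k. 0 \<le> k \<and> k < 2 * m \<and> L k = y"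
    and sums: "\<And>a. a \<noteq> 0 \<Longrightarrow> \<bar>a\<bar> \<le> m \<Longrightarrow>
      \<exists>k. 0 \<le> k \<and> k < 2 * m \<and> L k + L ((k - 1) mod (2 * m)) = 2 * m + 1 - a"
  shows "\<exists>f. diagonals n 3 f"
proof (rule diagonals_3[where b = "\<lambda>i. m + L (i mod (2 * m))" and K = "4 * m + 1"])
  show "m + L (i mod int n mod (2 * m)) = m + L (i mod (2 * m))" for i
    by (simp add: n)
  fix x assume x: "x \<in> sms_entries n 3"
  have "int (n * 3 div 2) = 3 * m" "even n" using n by presburger+
  then have "\<bar>x\<bar> \<le> 3 * m" "x \<noteq> 0" using x by (simp_all add: mem_sms_entries_iff)
  then consider "m < x" "x \<le> 3 * m" | "x < - m" "- (3 * m) \<le> x" | "x \<noteq> 0" "\<bar>x\<bar> \<le> m"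
    by linarith
  then show "\<exists>i. x = m + L (i mod (2 * m)) \<or> x = m + L (i mod (2 * m)) - (4 * m + 1) \<or>
      x = 4 * m + 1 - (m + L (i mod (2 * m))) - (m + L ((i - 1) mod (2 * m)))"
  proof cases
    case 1
    then obtain k where "0 \<le> k" "k < 2 * m" "L k = x - m" using L[of "x - m"] by auto
    then show ?thesis by (intro exI[of _ k]) simp
  next
    case 2
    then obtain k where "0 \<le> k" "k < 2 * m" "L k = x + 3 * m + 1"
      using L[of "x + 3 * m + 1"] by auto
    then show ?thesis by (intro exI[of _ k]) simp
  next
    case 3
    then obtain k where "0 \<le> k" "k < 2 * m" "L k + L ((k - 1) mod (2 * m)) = 2 * m + 1 - x"
      using sums by blast
    then show ?thesis by (intro exI[of _ k]) simp
  qed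
qed

lemma diagonals_3_mult_4:
  assumes "n = 4 * q" "0 < q"
  shows "\<exists>f. diagonals n 3 f"
proof -
  define h where "h = int q"
  have h: "0 < h" using assms by (simp add: h_def)
  \<comment> \<open>The cycle 1, 2h + 1, 2, 2h + 2, ..., h, 3h, 3h + 1, h + 1, ..., 4h, 2h. Low and
    high values swap roles at \<open>k = 2 * h\<close>, which replaces the forbidden sum 4h + 1 by
    6h + 1.\<close>
  define L where "L = (\<lambda>k. if k < 2 * h
    then if even k then k div 2 + 1 else 2 * h + (k + 1) div 2
    else if even k then 2 * h + k div 2 + 1 else (k + 1) div 2)"
  show ?thesis
  proof (rule diagonals_3_even_of_cycle[where m = "2 * h" and L = L])
    show "int n = 2 * (2 * h)" using assms by (simp add: h_def)
    show "\<exists>k\<ge>0. k < 2 * (2 * h) \<and> L k = y" if "1 \<le> y" "y \<le> 2 * (2 * h)" for y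
    proof -
      define k where "k = (if y \<le> h then 2 * y - 2 else if y \<le> 3 * h \<and> y > 2 * h
        then 2 * y - 4 * h - 1 else if y \<le> 2 * h then 2 * y - 1 else 2 * y - 4 * h - 2)"
      have "0 \<le> k" "k < 2 * (2 * h)" "L k = y" using that by (auto simp: k_def L_def)
      then show ?thesis by blast
    qed
    show "\<exists>k\<ge>0. k < 2 * (2 * h) \<and> L k + L ((k - 1) mod (2 * (2 * h))) = 2 * (2 * h) + 1 - a"
      if a: "a \<noteq> 0" "\<bar>a\<bar> \<le> 2 * h" for a
    proof -
      \<comment> \<open>Position \<open>k\<close> has neighbour sum \<open>2 * h + k + 1\<close>,
        except for the junction \<open>k = 2 * h\<close>.\<close>
      define k where "k = (if a = - 2 * h then 2 * h else 2 * h - a)"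
      have k: "0 \<le> k" "k < 2 * (2 * h)" using a h by (auto simp: k_def)
      then have "(k - 1) mod (2 * (2 * h)) = (if k = 0 then 4 * h - 1 else k - 1)"
        using h by (simp add: mod_diff_1_eq)
      then have "L k + L ((k - 1) mod (2 * (2 * h))) = 2 * (2 * h) + 1 - a"
        using a h unfolding L_def k_def by (auto elim!: evenE oddE)
      then show ?thesis using k by blast
    qed
  qed
qed

lemma diagonals_3_mult_4_add_2:
  assumes "n = 4 * q + 2" "0 < q"
  shows "\<exists>f. diagonals n 3 f"
proof -
  define h where "h = int q"
  have h: "0 < h" using assms by (simp add: h_def)
  define m where "m = 2 * h + 1"
  \<comment> \<open>The cycle 2h + 1, 1, 2h + 2, 2, ..., 3h, h, 3h + 2, 3h + 1, 3h + 3, h + 1, ...,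
    4h + 2, 2h. The adjacent large values in the middle supply the two largest sums.\<close>
  define L where "L = (\<lambda>k. if k < 2 * h then if even k then m + k div 2 else (k + 1) div 2
    else if k = 2 * h then 3 * h + 2 else if k = 2 * h + 1 then 3 * h + 1
    else if even k then 2 * h + 2 + k div 2 else (k - 1) div 2)"
  show ?thesis
  proof (rule diagonals_3_even_of_cycle[where m = m and L = L])
    show "int n = 2 * m" using assms by (simp add: h_def m_def)
    show "\<exists>k\<ge>0. k < 2 * m \<and> L k = y" if "1 \<le> y" "y \<le> 2 * m" for y
    proof -
      define k where "k = (if y \<le> h then 2 * y - 1 else if y \<le> 2 * h then 2 * y + 1
        else if y \<le> 3 * h then 2 * (y - m) else if y = 3 * h + 1 then 2 * h + 1
        else if y = 3 * h + 2 then 2 * h else 2 * (y - 2 * h - 2))"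
      have "0 \<le> k" "k < 2 * m" "L k = y" using that h by (auto simp: k_def L_def m_def)
      then show ?thesis by blast
    qed
    show "\<exists>k\<ge>0. k < 2 * m \<and> L k + L ((k - 1) mod (2 * m)) = 2 * m + 1 - a"
      if a: "a \<noteq> 0" "\<bar>a\<bar> \<le> m" for a
    proof -
      have wit: "\<exists>k\<ge>0. k < 2 * m \<and> L k + L ((k - 1) mod (2 * m)) = 2 * m + 1 - a"
        if "0 < k" "k < 2 * m" "L k + L (k - 1) = 2 * m + 1 - a" for k
        using that by (intro exI[of _ k]) (simp add: mod_diff_1_eq)
      \<comment> \<open>Sums are \<open>m + k\<close> before the junction and \<open>m + k\<close>
        again after it, from \<open>k = 2 * h + 3\<close> on. The wrap-around gives
        \<open>a = 2\<close>, and the three junction positions give \<open>1\<close>,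
        \<open>1 - m\<close> and \<open>- m\<close>.\<close>
      consider "a \<ge> 3" | "a = 2" | "a = 1" | "a = 1 - m" | "a = - m" | "a < 0" "a > 1 - m"
        using a by linarith
      then show ?thesis
      proof cases
        case 1
        show ?thesis
          using 1 a h by (intro wit[of "m + 1 - a"]) (auto simp: L_def m_def elim!: evenE oddE)
      next
        case 2
        then show ?thesis
          using h by (intro exI[of _ 0]) (simp add: L_def m_def zmod_minus1)
      next
        case 3
        then show ?thesis using h by (intro wit[of "2 * h"]) (auto simp: L_def m_def)
      next
        case 4
        then show ?thesis using h by (intro wit[of "2 * h + 1"]) (auto simp: L_def m_def)
      next
        case 5
        then show ?thesis using h by (intro wit[of "2 * h + 2"]) (auto simp: L_def m_def)
      next
        case 6
        then show ?thesis
          using h by (intro wit[of "2 * h + 2 - a"]) (auto simp: L_def m_def elim!: evenE oddE)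
      qed
    qed
  qed
qed

text \<open>Since \<open>c\<close> is a reflection of \<open>b\<close>, the middle diagonal carries the differences of
  neighbours of \<open>L\<close>. The arrangement \<open>L\<close> runs through \<open>1, m, 2, m - 1, \<dots>\<close>, jumps by \<open>m\<close> and runs
  back through the translate of this zigzag, so every difference occurs with both signs.\<close>

lemma diagonals_5_even:
  assumes "even n" "0 < n"
  shows "\<exists>f. diagonals n 5 f"
proof -
  obtain q where q: "n = 2 * q" using assms by blast
  define m where "m = int q"
  have n: "int n = 2 * m" and m: "0 < m" using assms by (simp_all add: m_def q)
  define z where "z = (\<lambda>k. if even k then k div 2 + 1 else m - k div 2)"
  define L where "L = (\<lambda>i. let k = i mod (2 * m) in if k < m then z k else m + z (2 * m - 1 - k))"
  have L_mod: "L (i mod (2 * m)) = L i" for i by (simp add: L_def)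
  have z_surj: "\<exists>k. 0 \<le> k \<and> k < m \<and> z k = y" if "1 \<le> y" "y \<le> m" for y
  proof -
    define k where "k = (if 2 * (y - 1) < m then 2 * (y - 1) else 2 * (m - y) + 1)"
    have "0 \<le> k" "k < m" "z k = y" using that by (auto simp: k_def z_def)
    then show ?thesis by blast
  qed
  have L_surj: "\<exists>i. L i = y" if "1 \<le> y" "y \<le> 2 * m" for y
  proof (cases "y \<le> m")
    case True
    then obtain k where "0 \<le> k" "k < m" "z k = y" using z_surj \<open>1 \<le> y\<close> by blast
    then have "L k = y" by (simp add: L_def)
    then show ?thesis ..
  next
    case False
    then obtain k where "0 \<le> k" "k < m" "z k = y - m"
      using z_surj[of "y - m"] \<open>y \<le> 2 * m\<close> by auto
    then have "L (2 * m - 1 - k) = y" by (simp add: L_def)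
    then show ?thesis ..
  qed
  have low: "L k = z k" if "0 \<le> k" "k < m" for k
    using that by (simp add: L_def)
  have high: "L k = m + z (2 * m - 1 - k)" if "m \<le> k" "k < 2 * m" for k
    using that m by (simp add: L_def)
  have step: "z (k - 1) - z k = (if odd k then k - m else m - k)" for k
    by (auto simp: z_def elim!: evenE oddE)
  have diffs: "\<exists>i. L (i - 1) - L i = x" if x: "x \<noteq> 0" "\<bar>x\<bar> \<le> m" for x
  proof -
    \<comment> \<open>The values \<open>m\<close> and \<open>- m\<close> arise at the wrap-around
      and at the jump. Otherwise step \<open>j\<close> of the zigzag has length
      \<open>m - j\<close>, signed by the parity of \<open>j\<close>; the reversed run supplies the
      other sign.\<close>
    define j where "j = m - \<bar>x\<bar>"
    consider "x = m" | "x = - m" | "0 < j" "j < m" "odd j \<longleftrightarrow> x < 0"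
      | "0 < j" "j < m" "odd j \<longleftrightarrow> 0 < x"
      using x by (force simp: j_def)
    then show ?thesis
    proof cases
      case 1
      have "L (- 1) = L (2 * m - 1)"
        using L_mod[of "- 1"] m by (simp add: zmod_minus1)
      then show ?thesis using 1 m low[of 0] high[of "2 * m - 1"] by (intro exI[of _ 0]) simp
    next
      case 2
      then show ?thesis using m low[of "m - 1"] high[of m] by (intro exI[of _ m]) simp
    next
      case 3
      then have "L (j - 1) - L j = x"
        using low[of "j - 1"] low[of j] step[of j] by (auto simp: j_def)
      then show ?thesis ..
    next
      case 4
      then have "L (2 * m - j - 1) - L (2 * m - j) = z j - z (j - 1)"
        using high[of "2 * m - j - 1"] high[of "2 * m - j"] by simp
      also have "\<dots> = x" using 4 step[of j] by (auto simp: j_def)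
      finally show ?thesis ..
    qed
  qed
  show ?thesis
  \<comment> \<open>\<open>b\<close> covers \<open>3 * m + 1, ..., 5 * m\<close> and
    \<open>c\<close> covers \<open>m + 1, ..., 3 * m\<close>; \<open>K\<close> and \<open>L\<close>
    map these ranges to their negatives. The middle diagonal becomes
    \<open>L (i - 2) - L (i - 1)\<close>.\<close>
  proof (rule diagonals_5[where b = "\<lambda>i. 3 * m + L i" and K = "8 * m + 1"
        and c = "\<lambda>i. 3 * m + 1 - L i" and L = "4 * m + 1"])
    show "3 * m + L (i mod int n) = 3 * m + L i"
      "3 * m + 1 - L (i mod int n) = 3 * m + 1 - L i" for i
      by (simp_all add: n L_mod)
    fix x assume "x \<in> sms_entries n 5"
    then have "\<bar>x\<bar> \<le> 5 * m" "x \<noteq> 0" by (simp_all add: mem_sms_entries_iff m_def q)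
    then consider "3 * m < x" "x \<le> 5 * m" | "x < - (3 * m)" "- (5 * m) \<le> x"
      | "m < x" "x \<le> 3 * m" | "x < - m" "- (3 * m) \<le> x" | "x \<noteq> 0" "\<bar>x\<bar> \<le> m"
      by linarith
    then show "\<exists>i. x = 3 * m + L i \<or> x = 3 * m + L i - (8 * m + 1) \<or>
        x = 3 * m + 1 - L i \<or> x = 3 * m + 1 - L i - (4 * m + 1) \<or>
        x = 8 * m + 1 + (4 * m + 1) - (3 * m + L i) - (3 * m + L (i - 1))
          - (3 * m + 1 - L i) - (3 * m + 1 - L (i - 2))"
    proof cases
      case 1
      then obtain i where "L i = x - 3 * m" using L_surj[of "x - 3 * m"] by auto
      then show ?thesis by (intro exI[of _ i]) simp
    next
      case 2
      then obtain i where "L i = x + 5 * m + 1" using L_surj[of "x + 5 * m + 1"] by auto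
      then show ?thesis by (intro exI[of _ i]) simp
    next
      case 3
      then obtain i where "L i = 3 * m + 1 - x" using L_surj[of "3 * m + 1 - x"] by auto
      then show ?thesis by (intro exI[of _ i]) simp
    next
      case 4
      then obtain i where "L i = - m - x" using L_surj[of "- m - x"] by auto
      then show ?thesis by (intro exI[of _ i]) simp
    next
      case 5
      then obtain i where "L (i - 1) - L i = x" using diffs by blast
      then show ?thesis by (intro exI[of _ "i + 1"]) simp
    qed
  qed
qed

section \<open>Even order and even \<open>t\<close>: 2 by 2 blocks\<close>

text \<open>Each new block has rows \<open>P, - P\<close> and \<open>- (P + 1), P + 1\<close> up to
  a global sign: row sums vanish and column sums are -1 and 1. The second diagonal has the opposite
  sign, so columns cancel wherever the blocks lie.\<close>

lemma block_cyclic_2_add_2: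
  assumes f: "block_cyclic 2 m s f" and "0 < m"
  shows "\<exists>f. block_cyclic 2 m (s + 2) f"
proof -
  define S where "S = 2 * int (m * s)"
  define P where "P = (\<lambda>d I. S + 2 * (I mod int m) + (if d = s then 1 else 2 * int m + 1))"
  define g where "g = (\<lambda>d I u v. if d < s then f d I u v
    else (if d = s then 1 else - 1) * (if v = (0::nat) then 1 else - 1) *
      (if u = (0::nat) then P d I else - P d I - 1))"
  have two: "(\<Sum>u<2. h u) = h 0 + h 1" for h :: "nat \<Rightarrow> int"
    by (simp add: numeral_eq_Suc)
  have sum2: "(\<Sum>d<s + 2. h d) = (\<Sum>d<s. h d) + h s + h (s + 1)" for h :: "nat \<Rightarrow> int"
    by (simp add: numeral_eq_Suc)
  have "\<exists>d<s + 2. \<exists>I. \<exists>u<2. \<exists>v<2. g d I u v = x"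
    if x: "x \<in> sms_entries (m * 2) ((s + 2) * 2)" for x
  proof -
    have "m * 2 * ((s + 2) * 2) div 2 = 2 * (m * s) + 4 * m" by (simp add: algebra_simps)
    then have bound: "\<bar>x\<bar> \<le> S + 4 * int m" "x \<noteq> 0"
      using x by (simp_all add: mem_sms_entries_iff S_def)
    show ?thesis
    proof (cases "\<bar>x\<bar> \<le> S")
      case True
      then have "x \<in> sms_entries (m * 2) (s * 2)"
        using bound by (simp add: mem_sms_entries_iff S_def)
      then obtain d I u v where "d < s" "u < 2" "v < 2" "f d I u v = x"
        using f unfolding block_cyclic_def by blast
      then have "d < s + 2" "g d I u v = x" by (simp_all add: g_def)
      then show ?thesis using \<open>u < 2\<close> \<open>v < 2\<close> by blast
    next
      case False
      define y where "y = \<bar>x\<bar> - S - 1"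
      define d where "d = (if y < 2 * int m then s else s + 1)"
      define r where "r = (if y < 2 * int m then y else y - 2 * int m)"
      have "0 \<le> y" "y < 4 * int m" using False bound by (simp_all add: y_def)
      then have r: "0 \<le> r" "r < 2 * int m" by (simp_all add: r_def)
      then have "0 \<le> r div 2" "r div 2 < int m" by linarith+
      then have "(r div 2) mod int m = r div 2" by simp
      then have "P d (r div 2) + r mod 2 = \<bar>x\<bar>"
        using mult_div_mod_eq[of 2 r] by (simp add: P_def d_def r_def y_def)
      moreover have "r mod 2 = 0 \<or> r mod 2 = 1" by presburger
      ultimately have "g d (r div 2) 0 0 = x \<or> g d (r div 2) 0 1 = x \<or>
          g d (r div 2) 1 0 = x \<or> g d (r div 2) 1 1 = x"
        by (auto simp: g_def d_def)
      moreover have "d < s + 2" "(0::nat) < 2" "(1::nat) < 2" by (simp_all add: d_def)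
      ultimately show ?thesis by blast
    qed
  qed
  moreover have "g d (I mod int m) u v = g d I u v" if "d < s + 2" for d I u v
    using f by (simp add: g_def P_def block_cyclic_def)
  moreover have "(\<Sum>d<s + 2. \<Sum>v<2. g d I u v) = 0" if "u < 2" for I u
    using f that by (simp add: sum2) (simp add: g_def two block_cyclic_def)
  moreover have "(\<Sum>d<s + 2. \<Sum>u<2. g d (J - int d) u v) = 0" if "v < 2" for J v
    using f that by (simp add: sum2) (simp add: g_def two block_cyclic_def)
  ultimately have "block_cyclic 2 m (s + 2) g"
    unfolding block_cyclic_def by blast
  then show ?thesis by blast
qed

lemma block_cyclic_2_add_even:
  assumes "block_cyclic 2 m s f" and "0 < m"
  shows "\<exists>f. block_cyclic 2 m (s + 2 * k) f"
proof (induction k)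
  case 0
  then show ?case using assms by auto
next
  case (Suc k)
  then obtain f where "block_cyclic 2 m (s + 2 * k) f" by blast
  from block_cyclic_2_add_2[OF this \<open>0 < m\<close>] show ?case by (simp add: ac_simps)
qed

text \<open>A block carries \<open>\<plusminus>p\<close> and \<open>\<plusminus>q\<close>, arranged so that either its row sums or its column sums
  vanish. With \<open>q = p + 1\<close> throughout, every block row needs two blocks with nonzero row sums and
  every block column none or two with nonzero column sums; this is impossible by parity for odd
  \<open>m\<close>. Then the block at \<open>d = 0\<close>, \<open>k = 1\<close> gets row sums \<open>\<plusminus>1\<close> and column sums \<open>\<plusminus>3\<close> from
  \<open>{1, 2}\<close>, and the latter are cancelled by the block above it, with \<open>{3, 6}\<close>.\<close>

lemma block_cyclic_2_3:
  assumes "3 \<le> m"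
  shows "\<exists>f. block_cyclic 2 m 3 f"
proof -
  \<comment> \<open>By default the pairs are consecutive in reading order. For odd \<open>m\<close>,
    {1, 2} and {7, 8} trade places and {3, 4}, {5, 6} are regrouped as {3, 6}, {4, 5}.\<close>
  define p where "p = (\<lambda>(d::nat) k::int.
    if odd m \<and> k = 0 then if d = 0 then 7 else if d = 1 then 6 else 4
    else if odd m \<and> k = 1 \<and> d = 0 then 1 else 6 * k + 2 * int d + 1)"
  define q where "q = (\<lambda>(d::nat) k::int. if odd m \<and> k = 0 \<and> d = 1 then 3 else p d k + 1)"
  \<comment> \<open>The two blocks with nonzero row sums in a block row get opposite signs:
    \<open>d = 0, 2\<close> for even \<open>k\<close>, \<open>d = 0, 1\<close> for odd
    \<open>k\<close>.\<close>
  define e where "e = (\<lambda>(d::nat) k::int. if d = 0 \<or> odd k \<and> d = 2 then 1 else - 1 :: int)"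
  define B where "B = (\<lambda>(d::nat) k (u::nat) (v::nat).
    if odd m \<and> k = 1 \<and> d = 0 then
      if u = 0 then if v = 0 then p d k else - q d k else if v = 0 then q d k else - p d k
    else if d = (if odd k then 2 else 1) then
      e d k * (if v = 0 then 1 else - 1) * (if u = 0 then p d k else - q d k)
    else e d k * (if u = 0 then 1 else - 1) * (if v = 0 then p d k else - q d k))"
  define f where "f = (\<lambda>d I. B d (I mod int m))"
  have two: "(\<Sum>u<2. h u) = h 0 + h 1" and three: "(\<Sum>u<3. h u) = h 0 + h 1 + h 2"
    for h :: "nat \<Rightarrow> int"
    by (simp_all add: numeral_eq_Suc)
  have row: "(\<Sum>v<2. B d k u v) = (if u = 0 then 1 else - 1) *
      (if d = (if odd k then 2 else 1) then 0 else - e d k)" for d k u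
    by (auto simp: two B_def p_def q_def e_def)
  have col: "(\<Sum>u<2. B d k u v) = (if v = 0 then 1 else - 1) *
      (if odd m \<and> k = 1 \<and> d = 0 then 3 else if odd k \<and> d = 2 then - 1
       else if even k \<and> d = 1 then if odd m \<and> k = 0 then - 3 else 1 else 0)" for d k v
    by (auto simp: two B_def p_def q_def e_def)
  have m: "0 < int m" "3 \<le> int m" using assms by simp_all
  have colsum: "(\<Sum>d<3. \<Sum>u<2. f d (J - int d) u v) = 0" for J v
  proof -
    define k where "k = J mod int m"
    have k: "0 \<le> k" "k < int m" using m by (simp_all add: k_def)
    have k1: "(J - 1) mod int m = (if k = 0 then int m - 1 else k - 1)"
      using m by (simp add: mod_diff_1_eq k_def)
    have "(J - 2) mod int m = ((J - 1) - 1) mod int m" by simp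
    also have "\<dots> = (if k = 0 then int m - 2 else if k = 1 then int m - 1 else k - 2)"
      using m k by (subst mod_diff_1_eq) (auto simp: k1)
    finally have k2: "(J - 2) mod int m =
      (if k = 0 then int m - 2 else if k = 1 then int m - 1 else k - 2)" .
    \<comment> \<open>Up to the sign given by \<open>v\<close>, for \<open>k > 2\<close> an odd
      block column gets 1 from block row \<open>k - 1\<close> and -1 from \<open>k - 2\<close>, an
      even one nothing. Small \<open>k\<close> are separated because of the wrap-around and the
      special blocks for odd \<open>m\<close>.\<close>
    consider "k = 0" | "k = 1" | "k = 2" | "k > 2" using k by linarith
    then show ?thesis
      using k m by cases (auto simp: three f_def col k1 k2 k_def[symmetric])
  qed
  have rowsum: "(\<Sum>d<3. \<Sum>v<2. f d I u v) = 0" for I u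
    by (simp add: three f_def row e_def)
  have cover: "\<exists>d<3. \<exists>I. \<exists>u<2. \<exists>v<2. f d I u v = x"
    if x: "x \<in> sms_entries (m * 2) (3 * 2)" for x
  proof -
    have bound: "0 < \<bar>x\<bar>" "\<bar>x\<bar> \<le> 6 * int m"
      using x by (simp_all add: mem_sms_entries_iff)
    have "\<exists>d k. d < 3 \<and> 0 \<le> k \<and> k < int m \<and> (\<bar>x\<bar> = p d k \<or> \<bar>x\<bar> = q d k)"
    proof (cases "odd m \<and> \<bar>x\<bar> \<le> 8")
      case True
      then consider "\<bar>x\<bar> = 1 \<or> \<bar>x\<bar> = 2" | "\<bar>x\<bar> = 3 \<or> \<bar>x\<bar> = 6" | "\<bar>x\<bar> = 4 \<or> \<bar>x\<bar> = 5"
        | "\<bar>x\<bar> = 7 \<or> \<bar>x\<bar> = 8"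
        using bound by linarith
      then show ?thesis
      proof cases
        case 1
        then show ?thesis using True m by (intro exI[of _ 0] exI[of _ 1]) (auto simp: p_def q_def)
      next
        case 2
        then show ?thesis using True m by (intro exI[of _ 1] exI[of _ 0]) (auto simp: p_def q_def)
      next
        case 3
        then show ?thesis using True m by (intro exI[of _ 2] exI[of _ 0]) (auto simp: p_def q_def)
      next
        case 4
        then show ?thesis using True m by (intro exI[of _ 0] exI[of _ 0]) (auto simp: p_def q_def)
      qed
    next
      case False
      define y where "y = \<bar>x\<bar> - 1"
      define k where "k = y div 6"
      define d where "d = nat (y mod 6 div 2)"
      have y: "0 \<le> y" "y < 6 * int m" using bound by (simp_all add: y_def)
      have "int d = y mod 6 div 2" by (simp add: d_def)
      then have dk: "y = 6 * k + 2 * int d \<or> y = 6 * k + 2 * int d + 1" "d < 3"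
        unfolding k_def by presburger+
      have k: "0 \<le> k" "k < int m" using y unfolding k_def by linarith+
      have "\<not> (odd m \<and> k = 0)" "\<not> (odd m \<and> k = 1 \<and> d = 0)"
        using False dk unfolding y_def by auto
      then have "p d k = 6 * k + 2 * int d + 1" "q d k = 6 * k + 2 * int d + 2"
        by (auto simp: p_def q_def)
      then have "\<bar>x\<bar> = p d k \<or> \<bar>x\<bar> = q d k" using dk by (auto simp: y_def)
      then show ?thesis using k dk by blast
    qed
    then obtain d k where *: "d < 3" "0 \<le> k" "k < int m" "\<bar>x\<bar> = p d k \<or> \<bar>x\<bar> = q d k"
      by blast
    then have "x = p d k \<or> x = - p d k \<or> x = q d k \<or> x = - q d k" by linarith
    moreover have "e d k = 1 \<or> e d k = - 1" by (simp add: e_def)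
    ultimately have "B d k 0 0 = x \<or> B d k 0 1 = x \<or> B d k 1 0 = x \<or> B d k 1 1 = x"
      unfolding B_def by fastforce
    then have "f d k 0 0 = x \<or> f d k 0 1 = x \<or> f d k 1 0 = x \<or> f d k 1 1 = x"
      using * by (simp add: f_def)
    moreover have "(0::nat) < 2" "(1::nat) < 2" by simp_all
    ultimately show ?thesis using \<open>d < 3\<close> by blast
  qed
  have "f d (I mod int m) u v = f d I u v" for d I u v by (simp add: f_def)
  then have "block_cyclic 2 m 3 f"
    unfolding block_cyclic_def using rowsum colsum cover by blast
  then show ?thesis by blast
qed

section \<open>Existence for all \<open>t\<close> from 3 to \<open>n\<close>\<close>

lemma signed_magic_square_exists_even:
  assumes "even n" "even t" "3 \<le> t" "t \<le> n"
  shows "\<exists>A. signed_magic_square n t A"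
proof -
  obtain m s where n: "n = m * 2" and t: "t = s * 2"
    using assms by (metis evenE mult.commute)
  have ms: "2 \<le> s" "s \<le> m" using assms by (auto simp: n t)
  have "\<exists>f. block_cyclic 2 m s f"
  proof (cases "even s")
    case True
    have "block_cyclic 2 m 0 (\<lambda>_ _ _ _. 0)"
      by (simp add: block_cyclic_def mem_sms_entries_iff)
    then show ?thesis using block_cyclic_2_add_even[of m 0 _ "s div 2"] ms True by auto
  next
    case False
    then have "s = 3 + 2 * ((s - 3) div 2)" using ms by presburger
    then obtain k where k: "s = 3 + 2 * k" ..
    obtain f where "block_cyclic 2 m 3 f" using block_cyclic_2_3[of m] ms k by auto
    then show ?thesis using block_cyclic_2_add_even[of m 3 f k] ms k by auto
  qed
  then show ?thesis using signed_magic_square_of_block_cyclic[of 2 m s] ms by (auto simp: n t)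
qed

text \<open>Each residue of \<open>t\<close> modulo 4 starts from the base 0, 5, 6 or 3. In the case
  of residue 2, \<open>t\<close> is even, so \<open>n\<close> is odd and the six-diagonal base
  exists.\<close>

lemma signed_magic_square_exists_odd:
  assumes "odd n \<or> odd t" "3 \<le> t" "t \<le> n"
  shows "\<exists>A. signed_magic_square n t A"
proof -
  have pos: "0 < n" using assms by simp
  have three: "\<exists>f. diagonals n 3 f"
  proof (cases "even n")
    case True
    then have "n = 4 * (n div 4) \<or> n = 4 * (n div 4) + 2" "0 < n div 4"
      using assms by presburger+
    then show ?thesis using diagonals_3_mult_4 diagonals_3_mult_4_add_2 by blast
  qed (rule diagonals_3_odd)
  have five: "\<exists>f. diagonals n 5 f"
    using diagonals_5_odd diagonals_5_even pos by blast
  have add: "\<exists>f. diagonals n t f" if "\<exists>f. diagonals n r f" "t = r + 4 * k" for r k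
    using that diagonals_add_multiple_4 pos by blast
  have "t mod 4 = 0 \<or> t mod 4 = 1 \<or> t mod 4 = 2 \<or> t mod 4 = 3" by presburger
  then have "\<exists>f. diagonals n t f"
  proof (elim disjE, goal_cases)
    case 1
    then have "t = 0 + 4 * (t div 4)" by presburger
    then show ?thesis using add diagonals_0 by blast
  next
    case 2
    then have "t = 5 + 4 * (t div 4 - 1)" using assms by presburger
    then show ?thesis using add five by blast
  next
    case 3
    then have "t = 6 + 4 * (t div 4 - 1)" using assms by presburger
    moreover have "even t" using 3 by presburger
    ultimately show ?thesis using add diagonals_6_odd assms by blast
  next
    case 4
    then have "t = 3 + 4 * (t div 4)" by presburger
    then show ?thesis using add three by blast
  qed
  then show ?thesis
    using signed_magic_square_of_block_cyclic[of 1 n t] assms by (auto simp: diagonals_def)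
qed

section \<open>Necessity and conclusion\<close>

lemma signed_magic_square_1_imp:
  assumes A: "signed_magic_square n 1 A" and "1 \<le> n"
  shows "n = 1"
proof (rule ccontr)
  assume "n \<noteq> 1"
  \<comment> \<open>For \<open>n > 1\<close> the value 1 must occur; alone in its row, it makes the
    row sum 1.\<close>
  then have "1 \<in> sms_entries n 1" using assms by (simp add: mem_sms_entries_iff)
  then obtain i j where ij: "i < n" "j < n" "A i j = Some 1"
    using A unfolding signed_magic_square_def by blast
  have "card {j. j < n \<and> A i j \<noteq> None} = 1"
    and sum: "(\<Sum>j | j < n \<and> A i j \<noteq> None. the (A i j)) = 0"
    using A ij unfolding signed_magic_square_def by blast+
  then obtain k where k: "{j. j < n \<and> A i j \<noteq> None} = {k}" using card_1_singletonE by blast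
  have "j \<in> {k}" unfolding k[symmetric] using ij by simp
  with sum k ij show False by simp
qed

lemma not_signed_magic_square_2:
  assumes "1 \<le> n"
  shows "\<not> signed_magic_square n 2 A"
proof
  assume A: "signed_magic_square n 2 A"
  \<comment> \<open>Here \<open>g\<close> stands for a line through the entry 1; it is instantiated
    with a row and with a column.\<close>
  have pair: "\<exists>b. b \<noteq> a \<and> b < n \<and> g b = Some (- 1)"
    if two: "card {b. b < n \<and> g b \<noteq> None} = 2"
      and sum: "(\<Sum>b | b < n \<and> g b \<noteq> None. the (g b)) = 0"
      and a: "a < n" "g a = Some 1" for g :: "nat \<Rightarrow> int option" and a
  proof -
    have "a \<in> {b. b < n \<and> g b \<noteq> None}" using a by simp
    moreover obtain c d where "{b. b < n \<and> g b \<noteq> None} = {c, d}" "c \<noteq> d"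
      using two by (meson card_2_iff)
    ultimately obtain b where b: "{b. b < n \<and> g b \<noteq> None} = {a, b}" "b \<noteq> a"
      by (metis insertE insert_commute singletonD)
    then have "b < n" "g b \<noteq> None" by blast+
    moreover have "the (g a) + the (g b) = 0" using sum b by simp
    ultimately show ?thesis using b(2) a by auto
  qed
  have mem: "1 \<in> sms_entries n 2" "- 1 \<in> sms_entries n 2"
    using assms by (simp_all add: mem_sms_entries_iff)
  then obtain i j where ij: "i < n" "j < n" "A i j = Some 1"
    using A unfolding signed_magic_square_def by blast
  have row: "card {j. j < n \<and> A i j \<noteq> None} = 2"
      "(\<Sum>j | j < n \<and> A i j \<noteq> None. the (A i j)) = 0"
    and col: "card {i. i < n \<and> A i j \<noteq> None} = 2"
      "(\<Sum>i | i < n \<and> A i j \<noteq> None. the (A i j)) = 0"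
    using A ij unfolding signed_magic_square_def by blast+
  obtain j' where j': "j' \<noteq> j" "j' < n" "A i j' = Some (- 1)"
    using pair[OF row ij(2,3)] by blast
  obtain i' where i': "i' \<noteq> i" "i' < n" "A i' j = Some (- 1)"
    using pair[OF col ij(1,3)] by blast
  have "\<exists>!p. fst p < n \<and> snd p < n \<and> A (fst p) (snd p) = Some (- 1)"
    using A mem(2) unfolding signed_magic_square_def by blast
  then have "(i, j') = (i', j)"
    using ij j' i' by (metis fst_conv snd_conv)
  then show False using i' by simp
qed

theorem theorem10:
  fixes n t :: nat
  assumes "1 \<le> t" and "t \<le> n"
  shows "(\<exists>A. signed_magic_square n t A) \<longleftrightarrow> (n = 1 \<and> t = 1) \<or> (n > 2 \<and> t > 2)"
proof
  assume "\<exists>A. signed_magic_square n t A"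
  then obtain A where A: "signed_magic_square n t A" ..
  have "t \<noteq> 2" using A not_signed_magic_square_2 assms by auto
  moreover have "n = 1" if "t = 1" using A signed_magic_square_1_imp assms that by auto
  ultimately show "(n = 1 \<and> t = 1) \<or> (n > 2 \<and> t > 2)" using assms by linarith
next
  assume "(n = 1 \<and> t = 1) \<or> (n > 2 \<and> t > 2)"
  then show "\<exists>A. signed_magic_square n t A"
  proof
    assume "n = 1 \<and> t = 1"
    moreover have "signed_magic_square 1 1 (\<lambda>_ _. Some 0)"
      by (auto simp: signed_magic_square_def sms_entries_def)
    ultimately show ?thesis by blast
  next
    assume "n > 2 \<and> t > 2"
    then have "3 \<le> t" by simp
    then show ?thesis
      using signed_magic_square_exists_even signed_magic_square_exists_odd assms(2) by blast
  qed
qed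

end
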